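(* For any $m\in\mathbb{N}$ (positive integer), we have $$\varepsilon_0(m-1,m)=\sup\{\varepsilon>0\mid\mathcal{E}_\alpha\cap[\varepsilon,1-\varepsilon]^m\neq\varnothing\text{ for all }\alpha\in(\mathbb{Z}\setminus\{0\})^m\}.$$
   Context: For $\alpha\in\mathbb{R}^m$ let $\Lambda_\alpha=\{l\in\mathbb{Z}^m\mid l\cdot\alpha=0\}$ and $\mathcal{E}_\alpha=\{\xi\in\mathbb{R}^m\mid l\cdot\xi\in\mathbb{Z}\ \forall\, l\in\Lambda_\alpha\}$. Let $\dim_{\mathbb{Q}}(\alpha)$ be the dimension of the $\mathbb{Q}$-vector space generated by the coordinates of $\alpha$; $\alpha$ is rationally uniform if every $\dim_{\mathbb{Q}}(\alpha)$ coordinates of $\alpha$ (at distinct positions) are linearly independent over $\mathbb{Q}$. For $n\le m$ define $\varepsilon_0(n,m)$ as the supremum of all $\varepsilon\in[0,1/2]$ such that for every rationally uniform $v\in(\mathbb{R}\setminus\{0\})^m$ with $\dim_{\mathbb{Q}}(v)\ge m-n$, the line $\{tv\mid t\in\mathbb{R}\}$ taken modulo $\mathbb{Z}^m$ intersects $[\varepsilon,1-\varepsilon]^m$ (that is, $\{tv\mid t\in\mathbb{R}\}\cap([\varepsilon,1-\varepsilon]^m+\mathbb{Z}^m)\ne\varnothing$). The set $[\varepsilon,1-\varepsilon]^m$ is empty for $\varepsilon>1/2$. *)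

theory Defs
  imports "HOL-Analysis.Analysis"
begin

abbreviation scaleQ :: "rat \<Rightarrow> real \<Rightarrow> real" where
  "scaleQ q x \<equiv> of_rat q * x"

global_interpretation Q: vector_space scaleQ
  by unfold_locales (simp_all add: of_rat_add of_rat_mult algebra_simps)

text \<open>The dimension \<open>m\<close> is \<open>CARD('m)\<close>; integer vectors are real vectors with integer coordinates.\<close>

definition int_vecs :: "(real ^ 'm::finite) set" where
  "int_vecs = {l. \<forall>i. l $ i \<in> \<int>}"

definition Lambda :: "real ^ 'm::finite \<Rightarrow> (real ^ 'm) set" where
  "Lambda \<alpha> = {l \<in> int_vecs. l \<bullet> \<alpha> = 0}"

definition E_set :: "real ^ 'm::finite \<Rightarrow> (real ^ 'm) set" where
  "E_set \<alpha> = {\<xi>. \<forall>l \<in> Lambda \<alpha>. l \<bullet> \<xi> \<in> \<int>}"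

definition dimQ :: "real ^ 'm::finite \<Rightarrow> nat" where
  "dimQ \<alpha> = Q.dim (Q.span (range (($) \<alpha>)))"

text \<open>
  Independence is that of the family of coordinates at the positions in \<open>I\<close>; the injectivity
  condition rules out equal coordinates at distinct positions.
\<close>

definition rationally_uniform :: "real ^ 'm::finite \<Rightarrow> bool" where
  "rationally_uniform \<alpha> \<longleftrightarrow>
     (\<forall>I. card I = dimQ \<alpha> \<longrightarrow> inj_on (($) \<alpha>) I \<and> Q.independent (($) \<alpha> ` I))"

definition cube :: "real \<Rightarrow> (real ^ 'm::finite) set" where
  "cube \<epsilon> = {x. \<forall>i. x $ i \<in> {\<epsilon>..1 - \<epsilon>}}"

definition line_meets_cube :: "real ^ 'm::finite \<Rightarrow> real \<Rightarrow> bool" where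
  "line_meets_cube v \<epsilon> \<longleftrightarrow>
     {t *\<^sub>R v | t. t \<in> UNIV} \<inter> {x + z | x z. x \<in> cube \<epsilon> \<and> z \<in> int_vecs} \<noteq> {}"

text \<open>Intended for \<open>n \<le> CARD('m)\<close>, where the subtraction is not truncated.\<close>

definition eps0 :: "nat \<Rightarrow> 'm::finite itself \<Rightarrow> real" where
  "eps0 n TYPE('m) = Sup {\<epsilon> \<in> {0..1/2}. \<forall>v :: real ^ 'm.
     (\<forall>i. v $ i \<noteq> 0) \<longrightarrow> rationally_uniform v \<longrightarrow> CARD('m) - n \<le> dimQ v \<longrightarrow>
     line_meets_cube v \<epsilon>}"

end

theory Submission
  imports Defs
begin

text \<open>
  The line through \<open>v\<close>, taken modulo the integer lattice, always lies in \<open>E_set v\<close>, because an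
  integer vector orthogonal to \<open>v\<close> takes integer values on it. Both suprema therefore measure
  how deeply a set penetrates the unit cube, and the theorem says that the worst line can be
  sought among the closed ones, those with an integer direction vector.

  One inequality is this inclusion: a vector with nonzero integer coordinates has \<open>\<rat>\<close>-dimension
  one and is rationally uniform, so the closed lines are among those that \<open>eps0\<close> ranges over.

  For the other inequality let \<open>v\<close> have nonzero coordinates. Write
  \<open>v = (\<Sum>j. w j * u j)\<close> with reals \<open>w j\<close> independent over \<open>\<rat>\<close> and integer vectors \<open>u j\<close>.
  By Kronecker's theorem the multiples \<open>t * w j\<close> approximate any prescribed reals modulo one
  simultaneously, so the line through \<open>v\<close> comes arbitrarily close, modulo integers, to every real
  combination of the \<open>u j\<close>, and in particular to the whole line through any integer combination
  \<open>\<alpha>\<close> of the \<open>u j\<close>. The combination can be chosen with nonzero coordinates, and by Bezout's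
  identity \<open>E_set \<alpha>\<close> is exactly that line modulo integers. If \<open>E_set \<alpha>\<close> meets \<open>cube \<epsilon>\<close>, the line
  through \<open>v\<close> thus meets every larger cube \<open>cube \<epsilon>'\<close> with \<open>\<epsilon>' < \<epsilon>\<close>
  (\<open>line_meets_smaller_cube\<close>), which suffices for the suprema.

  The right-hand set must also be nonempty, as otherwise its supremum would be an arbitrary real.
  A union bound over the coordinates shows that it contains \<open>1 / (4 * m)\<close> in dimension \<open>m\<close>
  (\<open>integer_line_meets_cube\<close>).
\<close>

section \<open>Lines and cubes modulo the integer lattice\<close>

lemma line_meets_cube_iff:
  fixes v :: "real ^ 'm::finite"
  shows "line_meets_cube v \<epsilon> \<longleftrightarrow> (\<exists>t. \<forall>i. \<exists>z::int. t * v $ i - of_int z \<in> {\<epsilon>..1 - \<epsilon>})"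
proof
  assume "line_meets_cube v \<epsilon>"
  then obtain t x z where "t *\<^sub>R v = x + z" and x: "x \<in> cube \<epsilon>" and z: "z \<in> int_vecs"
    unfolding line_meets_cube_def by blast
  then have *: "t * v $ i = x $ i + z $ i" for i
    by (metis vector_add_component vector_scaleR_component real_scaleR_def)
  have "\<exists>k::int. t * v $ i - of_int k \<in> {\<epsilon>..1 - \<epsilon>}" for i
  proof -
    from z obtain k where "z $ i = of_int k" unfolding int_vecs_def by (auto elim: Ints_cases)
    with * x show ?thesis by (intro exI[of _ k]) (simp add: cube_def)
  qed
  then show "\<exists>t. \<forall>i. \<exists>z::int. t * v $ i - of_int z \<in> {\<epsilon>..1 - \<epsilon>}" by blast
next
  assume "\<exists>t. \<forall>i. \<exists>z::int. t * v $ i - of_int z \<in> {\<epsilon>..1 - \<epsilon>}"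
  then obtain t and z :: "'m \<Rightarrow> int" where tz: "\<And>i. t * v $ i - of_int (z i) \<in> {\<epsilon>..1 - \<epsilon>}"
    by metis
  define y :: "real ^ 'm" where "y = (\<chi> i. of_int (z i))"
  have "t *\<^sub>R v - y \<in> cube \<epsilon>" using tz by (simp add: cube_def y_def)
  moreover have "y \<in> int_vecs" by (simp add: int_vecs_def y_def)
  moreover have "t *\<^sub>R v = (t *\<^sub>R v - y) + y" by simp
  ultimately show "line_meets_cube v \<epsilon>" unfolding line_meets_cube_def by blast
qed

text \<open>
  A point of the cube that is congruent to a multiple of \<open>\<alpha>\<close> lies in \<open>E_set \<alpha>\<close> itself: pairing
  with an element of \<open>Lambda \<alpha>\<close> kills the multiple and leaves an integer.
\<close>

lemma line_meets_cube_imp_E_set: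
  fixes \<alpha> :: "real ^ 'm::finite"
  assumes "line_meets_cube \<alpha> \<epsilon>"
  shows "E_set \<alpha> \<inter> cube \<epsilon> \<noteq> {}"
proof -
  obtain t x z where txz: "t *\<^sub>R \<alpha> = x + z" "x \<in> cube \<epsilon>" "z \<in> int_vecs"
    using assms unfolding line_meets_cube_def by blast
  have "l \<bullet> x \<in> \<int>" if "l \<in> Lambda \<alpha>" for l
  proof -
    have "l \<bullet> (x + z) = 0" using that unfolding txz(1)[symmetric] by (simp add: Lambda_def)
    then have "l \<bullet> x = - (l \<bullet> z)" by (simp add: inner_add_right)
    moreover have "l \<bullet> z \<in> \<int>" using that txz(3)
      unfolding inner_vec_def by (intro Ints_sum) (auto simp: Lambda_def int_vecs_def)
    ultimately show ?thesis by simp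
  qed
  then show ?thesis using txz(2) by (auto simp: E_set_def)
qed

section \<open>Integer directions\<close>

lemma rationally_uniform_integer_vector:
  fixes \<alpha> :: "real ^ 'm::finite"
  assumes int: "\<And>i. \<alpha> $ i \<in> \<int>" and nz: "\<And>i. \<alpha> $ i \<noteq> 0"
  shows "dimQ \<alpha> = 1" and "rationally_uniform \<alpha>"
proof -
  have "\<alpha> $ i \<in> Q.span {1}" for i
  proof -
    from int[of i] obtain k where "\<alpha> $ i = of_int k" by (auto elim: Ints_cases)
    then have "\<alpha> $ i = scaleQ (of_int k) 1" by simp
    then show ?thesis by (metis Q.span_base Q.span_scale singletonI)
  qed
  then have sub: "range (($) \<alpha>) \<subseteq> Q.span {1}" by auto
  obtain i :: 'm where True by simp
  from int[of i] obtain k where k: "\<alpha> $ i = of_int k" by (auto elim: Ints_cases)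
  have "(1::real) = scaleQ (1 / of_int k) (\<alpha> $ i)"
    using nz[of i] k by (simp add: of_rat_divide)
  then have "(1::real) \<in> Q.span (range (($) \<alpha>))"
    by (metis Q.span_base Q.span_scale rangeI)
  with sub have span: "Q.span (range (($) \<alpha>)) = Q.span {1}"
    by (metis Q.span_eq empty_subsetI insert_subset)
  have "Q.independent {1::real}" by simp
  then show dim: "dimQ \<alpha> = 1"
    unfolding dimQ_def span Q.dim_span by (simp add: Q.dim_eq_card_independent)
  show "rationally_uniform \<alpha>"
    unfolding rationally_uniform_def dim using nz by (auto simp: card_1_singleton_iff)
qed

lemma bezout_family_int:
  fixes a :: "'i \<Rightarrow> int"
  assumes "finite I"
  shows "\<exists>b. (\<Sum>i\<in>I. b i * a i) = Gcd (a ` I)"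
  using assms
proof induction
  case empty
  then show ?case by simp
next
  case (insert j I)
  then obtain b where b: "(\<Sum>i\<in>I. b i * a i) = Gcd (a ` I)" by blast
  obtain x y where xy: "x * a j + y * Gcd (a ` I) = gcd (a j) (Gcd (a ` I))"
    using bezout_int by blast
  have "(\<Sum>i\<in>insert j I. (if i = j then x else y * b i) * a i)
      = x * a j + (\<Sum>i\<in>I. (if i = j then x else y * b i) * a i)"
    using insert.hyps by simp
  also have "(\<Sum>i\<in>I. (if i = j then x else y * b i) * a i) = (\<Sum>i\<in>I. y * (b i * a i))"
    using insert.hyps by (intro sum.cong) auto
  also have "\<dots> = y * Gcd (a ` I)" by (simp add: b flip: sum_distrib_left)
  also have "x * a j + y * Gcd (a ` I) = Gcd (a ` insert j I)"
    by (simp add: xy)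
  finally show ?case by (rule exI[of _ "\<lambda>i. if i = j then x else y * b i"])
qed

text \<open>
  With \<open>g\<close> the gcd of the coordinates of \<open>\<alpha>\<close> and \<open>b\<close> Bezout coefficients for it, the
  integer vectors \<open>e\<^sub>i - (\<alpha>\<^sub>i / g) b\<close> are orthogonal to \<open>\<alpha>\<close>. Pairing them with \<open>\<xi>\<close> shows
  \<open>\<xi>\<^sub>i\<close> to be congruent to \<open>(b \<bullet> \<xi> / g) \<alpha>\<^sub>i\<close>, where the factor of \<open>\<alpha>\<^sub>i\<close> is the same for all \<open>i\<close>.
\<close>

lemma E_set_integer_vector:
  fixes \<alpha> \<xi> :: "real ^ 'm::finite"
  assumes \<xi>: "\<xi> \<in> E_set \<alpha>" and int: "\<And>i. \<alpha> $ i \<in> \<int>" and nz: "\<alpha> \<noteq> 0"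
  shows "\<exists>t. \<forall>i. \<xi> $ i - t * \<alpha> $ i \<in> \<int>"
proof -
  from int have "\<forall>i. \<exists>k. \<alpha> $ i = of_int k" by (metis Ints_cases)
  then obtain a :: "'m \<Rightarrow> int" where a: "\<And>i. \<alpha> $ i = of_int (a i)" by metis
  define g where "g = Gcd (range a)"
  obtain b where b: "(\<Sum>i\<in>UNIV. b i * a i) = g"
    using bezout_family_int[of UNIV a] unfolding g_def by auto
  from nz obtain i where "\<alpha> $ i \<noteq> 0" by (auto simp: vec_eq_iff)
  then have "a i \<noteq> 0" using a[of i] by auto
  then have "g \<noteq> 0" unfolding g_def by (auto simp: Gcd_0_iff)
  define T where "T = (\<Sum>j\<in>UNIV. of_int (b j) * \<xi> $ j) / of_int g"
  have "\<xi> $ i - T * \<alpha> $ i \<in> \<int>" for i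
  proof -
    obtain q where q: "a i = g * q" unfolding g_def by (metis Gcd_dvd UNIV_I dvdE image_eqI)
    define l :: "real ^ 'm" where "l = (\<chi> j. of_int ((if j = i then 1 else 0) - q * b j))"
    have l_inner: "l \<bullet> x = x $ i - of_int q * (\<Sum>j\<in>UNIV. of_int (b j) * x $ j)" for x
    proof -
      have "l \<bullet> x = (\<Sum>j\<in>UNIV. (if j = i then x $ j else 0) - of_int q * (of_int (b j) * x $ j))"
        unfolding inner_vec_def l_def by (intro sum.cong) (auto simp: algebra_simps)
      then show ?thesis by (simp add: sum_subtractf sum_distrib_left)
    qed
    have "(\<Sum>j\<in>UNIV. of_int (b j) * \<alpha> $ j) = of_int g"
      by (simp add: a flip: b)
    then have "l \<bullet> \<alpha> = 0" by (simp add: l_inner a q)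
    moreover have "l \<in> int_vecs" by (simp add: l_def int_vecs_def)
    ultimately have "l \<bullet> \<xi> \<in> \<int>" using \<xi> by (simp add: E_set_def Lambda_def)
    moreover have "T * \<alpha> $ i = of_int q * (\<Sum>j\<in>UNIV. of_int (b j) * \<xi> $ j)"
      using \<open>g \<noteq> 0\<close> by (simp add: T_def a q)
    ultimately show ?thesis by (simp add: l_inner)
  qed
  then show ?thesis by blast
qed

section \<open>Approximation by closed lines\<close>

text \<open>
  The \<open>w j\<close> are a \<open>\<rat>\<close>-basis of the span of the coordinates, divided by a common denominator of
  all coefficients that occur. Independence is stated over the integers, the form in which
  Kronecker's theorem uses it.
\<close>

lemma integral_coordinates_over_independent_family:
  fixes v :: "real ^ 'm::finite"
  obtains n :: nat and w :: "nat \<Rightarrow> real" and u :: "nat \<Rightarrow> 'm \<Rightarrow> int"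
  where "inj_on w {..<n}" and "module.independent (\<lambda>r. (*) (real_of_int r)) (w ` {..<n})"
    and "\<And>i. v $ i = (\<Sum>j<n. w j * of_int (u j i))"
proof -
  obtain B where B: "B \<subseteq> range (($) v)" "Q.independent B" "range (($) v) \<subseteq> Q.span B"
    using Q.basis_exists by metis
  have fin: "finite B" using B(1) by (rule finite_subset) simp
  have "\<exists>c. v $ i = (\<Sum>b\<in>B. scaleQ (c b) b)" for i
    using B(3) Q.span_finite[OF fin] by blast
  then obtain c where c: "\<And>i. v $ i = (\<Sum>b\<in>B. scaleQ (c i b) b)" by metis
  define den where "den i b = snd (quotient_of (c i b))" for i b
  define D where "D = (\<Prod>(i, b)\<in>UNIV \<times> B. den i b)"
  have den_pos: "den i b > 0" for i b by (simp add: den_def quotient_of_denom_pos')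
  then have "D > 0" unfolding D_def by (auto intro!: prod_pos)
  define k where "k i b = \<lfloor>of_int D * c i b\<rfloor>" for i b
  have k: "of_int D * c i b = of_int (k i b)" if "b \<in> B" for i b
  proof -
    have "(case (i, b) of (i, b) \<Rightarrow> den i b) dvd D"
      unfolding D_def using that fin by (intro dvd_prodI) auto
    then have "den i b dvd D" by simp
    then obtain e where e: "D = den i b * e" by blast
    have "c i b = of_int (fst (quotient_of (c i b))) / of_int (den i b)"
      unfolding den_def by (simp add: quotient_of_div prod.collapse)
    then have "of_int D * c i b = of_int (e * fst (quotient_of (c i b)))"
      using den_pos[of i b] by (simp add: e field_simps)
    then show ?thesis unfolding k_def by (simp only: floor_of_int)
  qed
  obtain h where h: "bij_betw h {..<card B} B"
    using fin bij_betw_from_nat_into_finite by blast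
  define w where "w j = h j / of_int D" for j
  have inj: "inj_on w {..<card B}"
    using h \<open>D > 0\<close> unfolding w_def bij_betw_def inj_on_def by simp
  interpret Z: Modules.module "\<lambda>r. (*) (real_of_int r)"
    by unfold_locales (auto simp: algebra_simps)
  have ind: "Z.independent (w ` {..<card B})"
  proof (subst Z.independent_explicit_module, intro allI impI)
    fix S f x
    assume S: "finite S" "S \<subseteq> w ` {..<card B}" and z: "(\<Sum>x\<in>S. real_of_int (f x) * x) = 0" "x \<in> S"
    \<comment> \<open>An integer relation among the \<open>w j\<close>, rescaled by \<open>D\<close>, is a rational relation on the basis.\<close>
    define g where "g b = (if b / of_int D \<in> S then of_int (f (b / of_int D)) else 0 :: rat)" for b :: real
    have "(\<Sum>b\<in>B. scaleQ (g b) b) = (\<Sum>j<card B. scaleQ (g (h j)) (h j))"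
      by (rule sum.reindex_bij_betw[OF h, symmetric])
    also have "\<dots> = (\<Sum>j<card B. of_int D * (if w j \<in> S then of_int (f (w j)) * w j else 0))"
      using \<open>D > 0\<close> by (intro sum.cong) (auto simp: g_def w_def)
    also have "\<dots> = of_int D * (\<Sum>y\<in>w ` {..<card B}. if y \<in> S then of_int (f y) * y else 0)"
      using inj by (simp add: sum.reindex sum_distrib_left)
    also have "(\<Sum>y\<in>w ` {..<card B}. if y \<in> S then of_int (f y) * y else 0) = (\<Sum>x\<in>S. real_of_int (f x) * x)"
      using S by (simp add: Int_absorb1 flip: sum.inter_restrict)
    finally have "(\<Sum>b\<in>B. scaleQ (g b) b) = 0" using z by simp
    then have g0: "\<And>b. b \<in> B \<Longrightarrow> g b = 0"
      using Q.independentD[OF B(2) fin subset_refl] by blast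
    obtain j where j: "j < card B" "x = w j" using S z by blast
    then have "g (h j) = 0" using h by (intro g0) (auto simp: bij_betw_def)
    then show "f x = 0" using j z by (simp add: g_def w_def)
  qed
  have "v $ i = (\<Sum>j<card B. w j * of_int (k i (h j)))" for i
  proof -
    have "v $ i = (\<Sum>j<card B. scaleQ (c i (h j)) (h j))"
      unfolding c by (rule sum.reindex_bij_betw[OF h, symmetric])
    also have "\<dots> = (\<Sum>j<card B. w j * of_int (k i (h j)))"
    proof (intro sum.cong refl)
      fix j assume "j \<in> {..<card B}"
      then have "h j \<in> B" using h by (auto simp: bij_betw_def)
      from k[OF this] have "real_of_rat (of_int D * c i (h j)) = of_int (k i (h j))" by simp
      then have "of_int D * real_of_rat (c i (h j)) = of_int (k i (h j))" by (simp add: of_rat_mult)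
      then show "scaleQ (c i (h j)) (h j) = w j * of_int (k i (h j))"
        using \<open>D > 0\<close> by (simp add: w_def field_simps)
    qed
    finally show ?thesis .
  qed
  with inj ind show thesis by (rule that[of w "card B" "\<lambda>j i. k i (h j)"])
qed

text \<open>
  Every real combination of the integer vectors \<open>u j\<close> is approximated, modulo integers, by
  multiples of the single combination with coefficients \<open>w j\<close>. Integrality of the \<open>u j\<close> ensures
  that the integer errors in Kronecker's theorem remain integers in every coordinate.
\<close>

lemma Kronecker_integer_combination:
  fixes w s :: "nat \<Rightarrow> real" and u :: "nat \<Rightarrow> 'm::finite \<Rightarrow> int"
  assumes inj: "inj_on w {..<n}"
    and ind: "module.independent (\<lambda>r. (*) (real_of_int r)) (w ` {..<n})"
    and "\<delta> > 0"
  shows "\<exists>t. \<forall>i. \<exists>z::int.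
    \<bar>t * (\<Sum>j<n. w j * of_int (u j i)) - of_int z - (\<Sum>j<n. s j * of_int (u j i))\<bar> \<le> \<delta>"
proof -
  \<comment> \<open>\<open>K\<close> bounds the amplification of the error; \<open>K + 1\<close> is positive even if all \<open>u j i\<close> vanish.\<close>
  define K where "K = (\<Sum>i\<in>UNIV. \<Sum>j<n. \<bar>real_of_int (u j i)\<bar>)"
  have K: "(\<Sum>j<n. \<bar>real_of_int (u j i)\<bar>) \<le> K" for i
    unfolding K_def by (rule member_le_sum) (auto intro: sum_nonneg)
  have "K \<ge> 0" unfolding K_def by (intro sum_nonneg) auto
  with \<open>\<delta> > 0\<close> have "\<delta> / (K + 1) > 0" by simp
  then obtain t h where th: "\<And>j. j < n \<Longrightarrow> \<bar>t * w j - of_int (h j) - s j\<bar> < \<delta> / (K + 1)"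
    using Kronecker_thm_1[OF ind inj] by metis
  have "\<bar>t * (\<Sum>j<n. w j * of_int (u j i)) - of_int (\<Sum>j<n. h j * u j i)
      - (\<Sum>j<n. s j * of_int (u j i))\<bar> \<le> \<delta>" (is "\<bar>?lhs\<bar> \<le> _") for i
  proof -
    have "?lhs = (\<Sum>j<n. (t * w j - of_int (h j) - s j) * of_int (u j i))"
      by (simp add: sum_distrib_left algebra_simps sum_subtractf sum.distrib)
    then have "\<bar>?lhs\<bar> \<le> (\<Sum>j<n. \<bar>(t * w j - of_int (h j) - s j) * of_int (u j i)\<bar>)"
      by (simp only: sum_abs)
    also have "\<dots> \<le> (\<Sum>j<n. \<delta> / (K + 1) * \<bar>of_int (u j i)\<bar>)"
      unfolding abs_mult by (intro sum_mono mult_right_mono less_imp_le[OF th]) auto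
    also have "\<dots> \<le> \<delta> / (K + 1) * K"
      unfolding sum_distrib_left[symmetric]
      using K[of i] \<open>\<delta> / (K + 1) > 0\<close> by (intro mult_left_mono) auto
    also have "\<dots> \<le> \<delta>" using \<open>\<delta> > 0\<close> \<open>K \<ge> 0\<close> by (simp add: field_simps)
    finally show ?thesis .
  qed
  then show ?thesis by blast
qed

text \<open>
  Powers of one integer \<open>x\<close> serve as coefficients: each coordinate then becomes a nonzero
  polynomial in \<open>x\<close>, and finitely many such polynomials have finitely many roots altogether.
\<close>

lemma integer_combination_nonzero_coordinates:
  fixes u :: "nat \<Rightarrow> 'm::finite \<Rightarrow> int"
  assumes "\<And>i. \<exists>j<n. u j i \<noteq> 0"
  shows "\<exists>k. \<forall>i. (\<Sum>j<n. k j * u j i) \<noteq> 0"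
proof -
  have "finite {x::int. (\<Sum>j<n. u j i * x ^ j) = 0}" for i
  proof -
    obtain j where j: "j < n" "u j i \<noteq> 0" using assms by blast
    then obtain N where N: "n = Suc N" by (cases n) auto
    have "finite {x::real. (\<Sum>j\<le>N. of_int (u j i) * x ^ j) = 0}"
      unfolding polyfun_finite_roots using j N by (auto simp: less_Suc_eq_le)
    then have "finite (real_of_int -` {x. (\<Sum>j\<le>N. of_int (u j i) * x ^ j) = 0})"
      by (rule finite_vimageI) (simp add: inj_on_def)
    moreover have "{x::int. (\<Sum>j<n. u j i * x ^ j) = 0}
        = real_of_int -` {x. (\<Sum>j\<le>N. of_int (u j i) * x ^ j) = 0}"
      unfolding N lessThan_Suc_atMost
      by (auto simp flip: of_int_mult of_int_power of_int_sum)
    ultimately show ?thesis by simp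
  qed
  then have "finite (\<Union>i. {x::int. (\<Sum>j<n. u j i * x ^ j) = 0})" by simp
  then obtain x where "x \<notin> (\<Union>i. {x::int. (\<Sum>j<n. u j i * x ^ j) = 0})"
    using ex_new_if_finite infinite_UNIV_int by blast
  then show ?thesis by (intro exI[of _ "\<lambda>j. x ^ j"]) (simp add: mult.commute)
qed

text \<open>
  The cube shrinks by a positive amount because a line that is not closed only comes arbitrarily
  close to the points of the closed line chosen for it.
\<close>

lemma line_meets_smaller_cube:
  fixes v :: "real ^ 'm::finite"
  assumes E: "\<And>\<alpha> :: real ^ 'm. (\<And>i. \<alpha> $ i \<in> \<int> - {0}) \<Longrightarrow> E_set \<alpha> \<inter> cube \<epsilon> \<noteq> {}"
    and nz: "\<And>i. v $ i \<noteq> 0" and less: "\<epsilon>' < \<epsilon>"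
  shows "line_meets_cube v \<epsilon>'"
proof -
  obtain n w and u :: "nat \<Rightarrow> 'm \<Rightarrow> int" where inj: "inj_on w {..<n}"
    and ind: "module.independent (\<lambda>r. (*) (real_of_int r)) (w ` {..<n})"
    and v: "\<And>i. v $ i = (\<Sum>j<n. w j * of_int (u j i))"
    using integral_coordinates_over_independent_family[of v] by metis
  have "\<exists>j<n. u j i \<noteq> 0" for i
    using nz[of i] v[of i] by (force intro: sum.neutral)
  then obtain k where k: "\<And>i. (\<Sum>j<n. k j * u j i) \<noteq> 0"
    using integer_combination_nonzero_coordinates by metis
  define \<alpha> :: "real ^ 'm" where "\<alpha> = (\<chi> i. of_int (\<Sum>j<n. k j * u j i))"
  have \<alpha>: "\<alpha> $ i \<in> \<int> - {0}" for i
    using k[of i] unfolding \<alpha>_def vec_lambda_beta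
    by (metis DiffI Ints_of_int of_int_eq_0_iff singletonD)
  then obtain \<xi> where \<xi>: "\<xi> \<in> E_set \<alpha>" "\<xi> \<in> cube \<epsilon>" using E by blast
  have "\<alpha> \<noteq> 0" using \<alpha>[of undefined] by auto
  with \<xi>(1) obtain s where "\<And>i. \<xi> $ i - s * \<alpha> $ i \<in> \<int>"
    using E_set_integer_vector[of \<xi> \<alpha>] \<alpha> by blast
  then have "\<exists>z. \<xi> $ i - s * \<alpha> $ i = of_int z" for i by (metis Ints_cases)
  then obtain y where y: "\<And>i. \<xi> $ i - s * \<alpha> $ i = of_int (y i)" by metis
  have s\<alpha>: "s * \<alpha> $ i = (\<Sum>j<n. (s * of_int (k j)) * of_int (u j i))" for i
    by (simp add: \<alpha>_def sum_distrib_left mult.assoc)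
  from Kronecker_integer_combination[OF inj ind, of "\<epsilon> - \<epsilon>'" u "\<lambda>j. s * of_int (k j)"] less
  obtain t where t: "\<And>i. \<exists>z::int. \<bar>t * v $ i - of_int z - s * \<alpha> $ i\<bar> \<le> \<epsilon> - \<epsilon>'"
    unfolding s\<alpha> v by auto
  have "\<exists>z::int. t * v $ i - of_int z \<in> {\<epsilon>'..1 - \<epsilon>'}" for i
  proof -
    obtain z :: int where "\<bar>t * v $ i - of_int z - s * \<alpha> $ i\<bar> \<le> \<epsilon> - \<epsilon>'" using t by blast
    moreover have "\<epsilon> \<le> \<xi> $ i" "\<xi> $ i \<le> 1 - \<epsilon>" using \<xi>(2) by (auto simp: cube_def)
    ultimately show ?thesis using y[of i] by (intro exI[of _ "z - y i"]) (auto simp: abs_le_iff)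
  qed
  then show ?thesis unfolding line_meets_cube_iff by blast
qed

section \<open>A uniform bound for closed lines\<close>

text \<open>
  Sample the line at the times \<open>k / p\<close> with \<open>0 \<le> k < p\<close>. If \<open>p\<close> is coprime to the coordinate
  \<open>a i\<close>, \<open>k * a i\<close> runs through every residue modulo \<open>p\<close> once, so this coordinate is close to an
  integer for only a small fraction of the times, and fewer than \<open>p\<close> times are bad for some
  coordinate. The bound depends only on the dimension, not on \<open>\<alpha>\<close>.
\<close>

lemma integer_line_meets_cube:
  fixes \<alpha> :: "real ^ 'm::finite"
  assumes \<alpha>: "\<And>i. \<alpha> $ i \<in> \<int> - {0}"
  shows "line_meets_cube \<alpha> (1 / (4 * CARD('m)))"
proof -
  from \<alpha> have "\<forall>i. \<exists>k. \<alpha> $ i = of_int k" by (metis DiffD1 Ints_cases)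
  then obtain a :: "'m \<Rightarrow> int" where a: "\<And>i. \<alpha> $ i = of_int (a i)" by metis
  have a0: "a i \<noteq> 0" for i using \<alpha>[of i] a[of i] by auto
  define m where "m = int CARD('m)"
  have m: "m \<ge> 1" by (simp add: m_def Suc_le_eq)
  define P where "P = \<bar>prod a UNIV\<bar>"
  have "P > 0" using a0 by (simp add: P_def)
  \<comment> \<open>Congruent to \<open>1\<close> modulo every \<open>a i\<close>, hence coprime to all of them, and so large that the
    \<open>2 * P + 1\<close> bad residues make up less than \<open>1 / m\<close> of all residues.\<close>
  define p where "p = 4 * m * P + 1"
  have "p > 0" using m \<open>P > 0\<close> by (simp add: p_def)
  have cop: "coprime (a i) p" for i
  proof -
    have "a i dvd P" unfolding P_def by (simp add: dvd_prodI)
    then have "a i dvd 4 * m * P" by simp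
    then show ?thesis unfolding p_def by (metis coprime_add_one_right coprime_divisors dvd_refl)
  qed
  define R where "R = {0..P} \<union> {p - P..<p}"
  define bad where "bad i = {k \<in> {0..<p}. k * a i mod p \<in> R}" for i
  have "card (bad i) \<le> nat (2 * P + 1)" for i
  proof -
    have "inj_on (\<lambda>k. k * a i mod p) (bad i)"
    proof (rule inj_onI)
      fix k k' assume k: "k \<in> bad i" "k' \<in> bad i" and "k * a i mod p = k' * a i mod p"
      then have "p dvd (k - k') * a i" by (simp add: mod_eq_dvd_iff algebra_simps)
      then have "p dvd k - k'" using cop coprime_dvd_mult_left_iff coprime_commute by blast
      then have "k mod p = k' mod p" by (simp add: mod_eq_dvd_iff)
      then show "k = k'" using k by (simp add: bad_def)
    qed
    then have "card (bad i) \<le> card R"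
      by (rule card_inj_on_le) (auto simp: bad_def R_def)
    also have "\<dots> \<le> card {0..P} + card {p - P..<p}" unfolding R_def by (rule card_Un_le)
    also have "\<dots> = nat (2 * P + 1)" using \<open>P > 0\<close> by simp
    finally show ?thesis .
  qed
  then have "card (\<Union>i. bad i) \<le> (\<Sum>i\<in>(UNIV::'m set). nat (2 * P + 1))"
    by (intro order.trans[OF card_UN_le] sum_mono) auto
  also have "\<dots> = nat (m * (2 * P + 1))" by (simp add: m_def nat_mult_distrib)
  also have "\<dots> < nat p"
  proof -
    have "m \<le> m * P" using m \<open>P > 0\<close> by simp
    then show ?thesis using \<open>p > 0\<close> unfolding p_def by (simp add: algebra_simps)
  qed
  also have "nat p = card {0..<p}" by simp
  finally have "\<not> {0..<p} \<subseteq> (\<Union>i. bad i)"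
    by (metis card_mono finite_UN_I finite finite_Collect_conjI finite_atLeastLessThan_int
        bad_def Collect_mem_eq linorder_not_le)
  then obtain k where "k \<in> {0..<p}" "\<And>i. k \<notin> bad i" by blast
  then have k: "k * a i mod p > P" "k * a i mod p < p - P" for i
    using \<open>p > 0\<close> pos_mod_bound[of p "k * a i"] pos_mod_sign[of p "k * a i"]
    by (auto simp: bad_def R_def not_le not_less)
  have "of_int k / of_int p * \<alpha> $ i - of_int (k * a i div p) \<in> {1 / (4 * CARD('m))..1 - 1 / (4 * CARD('m))}" for i
  proof -
    define r where "r = k * a i mod p"
    have "k * a i = p * (k * a i div p) + r" by (simp add: r_def)
    then have "real_of_int k * of_int (a i) = of_int p * of_int (k * a i div p) + of_int r"
      by (metis of_int_add of_int_mult)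
    then have *: "of_int k / of_int p * \<alpha> $ i - of_int (k * a i div p) = real_of_int r / of_int p"
      using \<open>p > 0\<close> by (simp add: a field_simps)
    have "p \<le> 4 * m * (P + 1)" using m by (simp add: p_def algebra_simps)
    also have "\<dots> \<le> 4 * m * r" using k(1)[of i] m by (intro mult_left_mono) (auto simp: r_def)
    finally have "real_of_int p \<le> real_of_int (4 * m * r)" by (simp only: of_int_le_iff)
    then have 1: "1 / (4 * real CARD('m)) \<le> of_int r / of_int p"
      using \<open>p > 0\<close> by (simp add: m_def field_simps)
    have "p \<le> 4 * m * (P + 1)" using m by (simp add: p_def algebra_simps)
    also have "\<dots> \<le> 4 * m * (p - r)" using k(2)[of i] m by (intro mult_left_mono) (auto simp: r_def)
    finally have "real_of_int p \<le> real_of_int (4 * m * (p - r))" by (simp only: of_int_le_iff)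
    then have 2: "of_int r / of_int p \<le> 1 - 1 / (4 * real CARD('m))"
      using \<open>p > 0\<close> by (simp add: m_def field_simps)
    show ?thesis unfolding * using 1 2 by simp
  qed
  then show ?thesis unfolding line_meets_cube_iff by blast
qed

section \<open>Equality of the suprema\<close>

theorem lemma5p3:
  shows "eps0 (CARD('m::finite) - 1) TYPE('m) =
    Sup {\<epsilon>::real. \<epsilon> > 0 \<and>
      (\<forall>\<alpha> :: real ^ 'm. (\<forall>i. \<alpha> $ i \<in> \<int> - {0}) \<longrightarrow> E_set \<alpha> \<inter> cube \<epsilon> \<noteq> {})}"
proof -
  \<comment> \<open>Below their suprema \<open>A\<close> and \<open>B\<close> contain the same positive numbers; only \<open>A\<close> contains \<open>0\<close>,
    which does not change the supremum because \<open>B\<close> has a positive element.\<close>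
  define A where "A = {\<epsilon> \<in> {0..1/2}. \<forall>v :: real ^ 'm. (\<forall>i. v $ i \<noteq> 0) \<longrightarrow>
    rationally_uniform v \<longrightarrow> CARD('m) - (CARD('m) - 1) \<le> dimQ v \<longrightarrow> line_meets_cube v \<epsilon>}"
  define B where "B = {\<epsilon>::real. \<epsilon> > 0 \<and>
    (\<forall>\<alpha> :: real ^ 'm. (\<forall>i. \<alpha> $ i \<in> \<int> - {0}) \<longrightarrow> E_set \<alpha> \<inter> cube \<epsilon> \<noteq> {})}"
  have B_half: "\<epsilon> \<le> 1/2" if "\<epsilon> \<in> B" for \<epsilon>
  proof -
    have "E_set (1 :: real ^ 'm) \<inter> cube \<epsilon> \<noteq> {}" using that by (simp add: B_def)
    then obtain x :: "real ^ 'm" where "x \<in> cube \<epsilon>" by blast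
    then have "\<epsilon> \<le> x $ undefined" "x $ undefined \<le> 1 - \<epsilon>" by (auto simp: cube_def)
    then show ?thesis by linarith
  qed
  have B_ne: "1 / (4 * CARD('m)) \<in> B"
    unfolding B_def using integer_line_meets_cube line_meets_cube_imp_E_set by auto
  have A_B: "\<epsilon> \<in> B" if "\<epsilon> \<in> A" "\<epsilon> > 0" for \<epsilon>
  proof -
    have "E_set \<alpha> \<inter> cube \<epsilon> \<noteq> {}" if \<alpha>: "\<forall>i. \<alpha> $ i \<in> \<int> - {0}" for \<alpha> :: "real ^ 'm"
    proof -
      have "CARD('m) - (CARD('m) - 1) \<le> 1" by simp
      then have "line_meets_cube \<alpha> \<epsilon>"
        using \<open>\<epsilon> \<in> A\<close> \<alpha> rationally_uniform_integer_vector[of \<alpha>] unfolding A_def by auto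
      then show ?thesis by (rule line_meets_cube_imp_E_set)
    qed
    then show ?thesis using \<open>\<epsilon> > 0\<close> by (simp add: B_def)
  qed
  have B_A: "\<epsilon>' \<in> A" if "\<epsilon> \<in> B" "0 \<le> \<epsilon>'" "\<epsilon>' < \<epsilon>" for \<epsilon> \<epsilon>'
    using that B_half[OF that(1)] line_meets_smaller_cube[of \<epsilon> _ \<epsilon>'] unfolding A_def B_def by auto
  have bdd: "bdd_above A" "bdd_above B"
    using B_half by (auto simp: A_def intro!: bdd_aboveI[of _ "1/2"])
  have "A \<noteq> {}" using B_A[OF B_ne, of 0] by auto
  then have "Sup A \<le> Sup B"
  proof (rule cSup_least)
    fix \<epsilon> assume "\<epsilon> \<in> A"
    have "0 < Sup B" using cSup_upper[OF B_ne bdd(2)] by (rule less_le_trans[rotated]) simp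
    then show "\<epsilon> \<le> Sup B"
      using A_B[OF \<open>\<epsilon> \<in> A\<close>] cSup_upper[OF _ bdd(2)] by (cases "\<epsilon> > 0") auto
  qed
  moreover have "Sup B \<le> Sup A"
  proof (rule cSup_least)
    show "B \<noteq> {}" using B_ne by blast
  next
    fix \<epsilon> assume \<epsilon>: "\<epsilon> \<in> B"
    then have "0 < \<epsilon>" by (simp add: B_def)
    then show "\<epsilon> \<le> Sup A"
      by (rule dense_le_bounded) (auto intro!: cSup_upper bdd B_A[OF \<epsilon>])
  qed
  ultimately show ?thesis unfolding eps0_def A_def B_def by (rule antisym)
qed

end
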